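(* Let $p_1,p_2>0$ satisfy $p_1+p_2<\frac12$. There exists $K>0$ such that for all $k\in\mathbb{N}$ satisfying $k\ge K$ and, with $k_1=k+\frac12$, for all $\gamma>0$ satisfying $$\frac38k_1^{-2p_2}\le\operatorname{arsinh}\frac{\gamma}{2\sqrt{k_1}}\le p_2\log k_1,$$ one has $$L_k^{(0)}(-\gamma^2)=\left(4\pi\gamma\sqrt{k_1+\frac{\gamma^2}{4}}\right)^{-1/2}e^{-\frac{\gamma^2}{2}+\gamma\sqrt{k_1+\frac{\gamma^2}{4}}+2k_1\operatorname{arsinh}\frac{\gamma}{2\sqrt{k_1}}}\left(1+\mathcal{O}(k^{-p_1})\right),$$ where $\mathcal{O}(k^{-p_1})$ denotes a quantity bounded in absolute value by $Ck^{-p_1}$ for a constant $C>0$ independent of $k$ and $\gamma$ (it may depend on $p_1,p_2$).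
   Context: $\mathbb{N}=\{0,1,2,\dots\}$. The Laguerre polynomials are $L_k^{(0)}(x)=\sum_{m=0}^k\frac{1}{m!}\binom{k}{m}(-x)^m$. *)

theory Defs
  imports Complex_Main
begin

definition laguerre :: "nat \<Rightarrow> real \<Rightarrow> real" where
  "laguerre k x = (\<Sum>m=0..k. 1 / fact m * real (k choose m) * (- x) ^ m)"

end

(*
  The function w(x) = sqrt x * exp (x/2) * L_k(-x) satisfies w'' = (1/4 + b/x - 1/(4 x^2)) w with b = k + 1/2,
  and the leading term of the theorem is its Liouville-Green approximation.  The logarithmic derivative of L_k(-x)
  solves a Riccati equation.  With R = sqrt (x^2 + 4 b x), the logarithmic derivative of the approximation, shifted by
  1/(x R) or by -20/(x R), is a strict super- or subsolution, so the two logarithmic derivatives differ by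
  O(1/(x R)) as soon as R >= 6.  Integrating from x to infinity gives an error O(1 / sqrt (b x)), and the constant at
  infinity is known because L_k(-x) ~ x^k / k!; comparing it with the approximation is Stirling's formula
  with an O(1/k) error.
*)
theory Submission
  imports Defs "HOL-Analysis.Analysis" "HOL-Real_Asymp.Real_Asymp"
begin

section \<open>The Riccati equation of the Laguerre polynomials\<close>

text \<open>The argument is negated so that all coefficients are nonnegative; positivity and the
  termwise bounds rest on this.\<close>

definition laguerre_neg :: "nat \<Rightarrow> real \<Rightarrow> real" where
  "laguerre_neg k x = (\<Sum>m\<le>k. real (k choose m) / fact m * x ^ m)"

text \<open>The Euler derivative \<open>x * y'\<close> of \<open>y = laguerre_neg k\<close> turns the Laguerre equation into the first-order
  system \<open>x * y' = z\<close>, \<open>z' = k * y - z\<close>.\<close>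

definition laguerre_euler :: "nat \<Rightarrow> real \<Rightarrow> real" where
  "laguerre_euler k x = (\<Sum>m\<le>k. real m * (real (k choose m) / fact m) * x ^ m)"

lemma laguerre_minus: "laguerre k (- x) = laguerre_neg k x"
  by (simp add: laguerre_def laguerre_neg_def atLeast0AtMost)

lemma laguerre_neg_ge_1:
  assumes "x \<ge> 0"
  shows "laguerre_neg k x \<ge> 1"
proof -
  have "(\<Sum>m\<in>{0}. real (k choose m) / fact m * x ^ m) \<le> laguerre_neg k x"
    unfolding laguerre_neg_def using assms by (intro sum_mono2) auto
  then show ?thesis by simp
qed

lemma laguerre_euler_nonneg: "x \<ge> 0 \<Longrightarrow> laguerre_euler k x \<ge> 0"
  unfolding laguerre_euler_def by (intro sum_nonneg) auto

text \<open>Termwise, since \<open>m \<le> k\<close>. With nonnegativity this confines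
  \<open>z / y\<close> to \<open>[0, k]\<close>, which supplies the initial inequalities of both
  barrier arguments.\<close>

lemma laguerre_euler_le: "x \<ge> 0 \<Longrightarrow> laguerre_euler k x \<le> k * laguerre_neg k x"
  unfolding laguerre_euler_def laguerre_neg_def sum_distrib_left mult.assoc
  by (intro sum_mono mult_right_mono) auto

lemma laguerre_neg_deriv:
  assumes "x > 0"
  shows "(laguerre_neg k has_real_derivative laguerre_euler k x / x) (at x)"
proof -
  have eq: "real m * (c * x ^ m) / x = c * (real m * x ^ (m - Suc 0))" for m :: nat and c
    using assms by (cases m) (auto simp: field_simps)
  have "((\<lambda>x. \<Sum>m\<le>k. real (k choose m) / fact m * x ^ m) has_real_derivative
      (\<Sum>m\<le>k. real (k choose m) / fact m * (real m * x ^ (m - Suc 0)))) (at x)"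
    by (rule DERIV_sum) (auto intro!: derivative_eq_intros)
  also have "(\<Sum>m\<le>k. real (k choose m) / fact m * (real m * x ^ (m - Suc 0))) = laguerre_euler k x / x"
    unfolding laguerre_euler_def sum_divide_distrib mult.assoc eq ..
  finally show ?thesis by (simp add: laguerre_neg_def[abs_def])
qed

text \<open>This is the Laguerre equation read coefficient by coefficient. It comes from the
  absorption identities for binomials; both sides vanish for \<open>m > k\<close>.\<close>

lemma laguerre_coeff_Suc:
  "real (Suc m) ^ 2 * (real (k choose Suc m) / fact (Suc m)) = (real k - real m) * (real (k choose m) / fact m)"
proof (cases "m \<le> k")
  case True
  have "Suc m * (k choose Suc m) = (k - m) * (k choose m)"
    by (simp only: binomial_absorption binomial_absorb_comp)
  then have "real (Suc m) * real (k choose Suc m) = (real k - real m) * real (k choose m)"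
    using True by (metis of_nat_diff of_nat_mult)
  then show ?thesis by (simp add: power2_eq_square field_simps del: binomial_Suc_Suc of_nat_Suc)
qed (simp add: binomial_eq_0 del: of_nat_Suc fact_Suc)

lemma laguerre_euler_deriv:
  "(laguerre_euler k has_real_derivative k * laguerre_neg k x - laguerre_euler k x) (at x)"
proof -
  define c where "c = (\<lambda>m. real (k choose m) / fact m)"
  have "((\<lambda>x. \<Sum>m\<le>k. real m * c m * x ^ m) has_real_derivative
      (\<Sum>m\<le>k. real m * c m * (real m * x ^ (m - Suc 0)))) (at x)"
    by (rule DERIV_sum) (auto intro!: derivative_eq_intros)
  \<comment> \<open>The added top term contains \<open>k choose Suc k = 0\<close>; it makes room for
    the index shift.\<close>
  also have "(\<Sum>m\<le>k. real m * c m * (real m * x ^ (m - Suc 0)))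
      = (\<Sum>m\<le>Suc k. real m ^ 2 * c m * x ^ (m - Suc 0))"
    by (simp add: c_def power2_eq_square mult_ac)
  also have "\<dots> = (\<Sum>m\<le>k. real (Suc m) ^ 2 * c (Suc m) * x ^ m)"
    by (subst sum.atMost_Suc_shift) simp
  also have "\<dots> = (\<Sum>m\<le>k. (real k - real m) * c m * x ^ m)"
    unfolding c_def laguerre_coeff_Suc ..
  also have "\<dots> = k * laguerre_neg k x - laguerre_euler k x"
    unfolding laguerre_neg_def laguerre_euler_def c_def
    unfolding sum_distrib_left mult.assoc left_diff_distrib sum_subtractf ..
  finally show ?thesis by (simp add: laguerre_euler_def[abs_def] c_def)
qed

text \<open>Only the leading term survives. Its coefficient later fixes the constant of integration
  at infinity.\<close>

lemma laguerre_neg_asymp: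
  "((\<lambda>x. laguerre_neg k x / x ^ k) \<longlongrightarrow> 1 / fact k) at_top"
proof -
  have "((\<lambda>x. \<Sum>m\<le>k. real (k choose m) / fact m * (x ^ m / x ^ k)) \<longlongrightarrow>
      (\<Sum>m\<le>k. real (k choose m) / fact m * (if m = k then 1 else 0))) at_top"
  proof (rule tendsto_sum, rule tendsto_mult[OF tendsto_const])
    fix m assume "m \<in> {..k}"
    show "((\<lambda>x::real. x ^ m / x ^ k) \<longlongrightarrow> (if m = k then 1 else 0)) at_top"
    proof (cases "m = k")
      case True
      have "eventually (\<lambda>x::real. 1 = x ^ m / x ^ k) at_top"
        using eventually_gt_at_top[of 0] by eventually_elim (simp add: True)
      with True show ?thesis by (intro tendsto_eventually) (auto elim: eventually_mono)
    next
      case False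
      with \<open>m \<in> {..k}\<close> have "m < k" by simp
      have "eventually (\<lambda>x::real. inverse (x ^ (k - m)) = x ^ m / x ^ k) at_top"
        using eventually_gt_at_top[of 0]
        by eventually_elim (use \<open>m < k\<close> in \<open>simp add: power_diff field_simps\<close>)
      moreover have "((\<lambda>x::real. inverse (x ^ (k - m))) \<longlongrightarrow> 0) at_top"
        using \<open>m < k\<close> by (intro tendsto_inverse_0_at_top filterlim_pow_at_top filterlim_ident) auto
      ultimately show ?thesis using False by (auto intro: Lim_transform_eventually)
    qed
  qed
  also have "(\<Sum>m\<le>k. real (k choose m) / fact m * (if m = k then 1 else 0)) = 1 / fact k"
    by (simp add: if_distrib[of "\<lambda>t. _ * t"] cong: if_cong)
  finally show ?thesis
    by (simp add: laguerre_neg_def sum_divide_distrib)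
qed

section \<open>Barrier comparison for the Riccati equation\<close>

lemma negative_of_negative_deriv_at_zeros:
  fixes F :: "real \<Rightarrow> real"
  assumes "a \<le> b" and "F a < 0"
    and der: "\<And>x. a \<le> x \<Longrightarrow> x \<le> b \<Longrightarrow> (F has_real_derivative F' x) (at x)"
    and neg: "\<And>x. a \<le> x \<Longrightarrow> x \<le> b \<Longrightarrow> F x = 0 \<Longrightarrow> F' x < 0"
  shows "F b < 0"
proof (rule ccontr)
  assume "\<not> F b < 0"
  have cont: "continuous_on {a..b} F"
    by (rule DERIV_atLeastAtMost_imp_continuous_on) (use der in blast)
  \<comment> \<open>The infimum of \<open>A\<close> is the first point at which \<open>F\<close> is
    nonnegative; by continuity \<open>F\<close> vanishes there.\<close>
  define A where "A = {a..b} \<inter> F -` {0..}"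
  have "closed A" unfolding A_def
    by (intro continuous_closed_preimage cont closed_atLeast closed_atLeastAtMost)
  have "b \<in> A" "bdd_below A" using \<open>\<not> F b < 0\<close> \<open>a \<le> b\<close> by (auto simp: A_def)
  define c where "c = Inf A"
  have "c \<in> A" unfolding c_def
    using \<open>closed A\<close> \<open>b \<in> A\<close> \<open>bdd_below A\<close> by (intro closed_contains_Inf) auto
  then have c: "a \<le> c" "c \<le> b" "F c \<ge> 0" by (auto simp: A_def)
  have below: "F x < 0" if "a \<le> x" "x < c" for x
  proof (rule ccontr)
    assume "\<not> F x < 0"
    with that c have "x \<in> A" by (auto simp: A_def)
    then have "c \<le> x" unfolding c_def using \<open>bdd_below A\<close> by (rule cInf_lower)
    with that show False by simp
  qed
  have "a < c" using c \<open>F a < 0\<close> by (cases "a = c") auto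
  have "F c = 0"
  proof (rule ccontr)
    assume "F c \<noteq> 0"
    have "\<exists>x\<ge>a. x \<le> c \<and> F x = 0"
      using \<open>F a < 0\<close> c cont by (intro IVT') (auto intro: continuous_on_subset)
    then obtain x where "a \<le> x" "x \<le> c" "F x = 0" by blast
    with below[of x] \<open>F c \<noteq> 0\<close> show False by (cases "x = c") auto
  qed
  with neg c have "F' c < 0" by simp
  \<comment> \<open>A negative derivative at \<open>c\<close> makes \<open>F\<close> positive just
    to the left, contradicting the choice of \<open>c\<close>.\<close>
  from DERIV_neg_dec_left[OF der[OF c(1,2)] this] obtain d
    where d: "d > 0" "\<And>h. h > 0 \<Longrightarrow> h < d \<Longrightarrow> F c < F (c - h)" by blast
  define h where "h = min (d / 2) (c - a)"
  have "h > 0" "h < d" "a \<le> c - h" using d \<open>a < c\<close> by (auto simp: h_def min_def)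
  with d(2)[of h] below[of "c - h"] \<open>F c = 0\<close> show False by simp
qed

lemma ln_laguerre_neg_deriv:
  assumes "x > 0"
  shows "((\<lambda>x. ln (laguerre_neg k x)) has_real_derivative
    laguerre_euler k x / (x * laguerre_neg k x)) (at x)"
  using laguerre_neg_ge_1[of x k] assms
  by (auto intro!: derivative_eq_intros laguerre_neg_deriv simp: field_simps)

text \<open>The quotient \<open>u = z / y\<close> solves \<open>u' + u + u\<^sup>2 / x = k\<close>,
  and \<open>U\<close> is a strict supersolution starting above it. The barrier argument is applied
  to \<open>z - U * y\<close>: at a zero, \<open>z = U * y\<close> turns its derivative into
  \<open>- y\<close> times the excess of \<open>U\<close> in the equation.\<close>

lemma laguerre_log_deriv_upper:
  fixes U U' :: "real \<Rightarrow> real"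
  assumes "0 < a" "a \<le> b"
    and init: "laguerre_euler k a < U a * laguerre_neg k a"
    and der: "\<And>x. a \<le> x \<Longrightarrow> x \<le> b \<Longrightarrow> (U has_real_derivative U' x) (at x)"
    and super: "\<And>x. a \<le> x \<Longrightarrow> x \<le> b \<Longrightarrow> U' x + U x + U x ^ 2 / x > k"
  shows "laguerre_euler k b < U b * laguerre_neg k b"
proof -
  define y where "y = laguerre_neg k"
  define z where "z = laguerre_euler k"
  have "z b - U b * y b < 0"
  proof (rule negative_of_negative_deriv_at_zeros[OF \<open>a \<le> b\<close>])
    show "z a - U a * y a < 0" using init by (simp add: y_def z_def)
    fix x assume x: "a \<le> x" "x \<le> b"
    show "((\<lambda>x. z x - U x * y x) has_real_derivative
      k * y x - z x - (U' x * y x + U x * (z x / x))) (at x)"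
      unfolding y_def z_def using x \<open>0 < a\<close>
      by (auto intro!: derivative_eq_intros der laguerre_neg_deriv laguerre_euler_deriv)
    assume "z x - U x * y x = 0"
    then have "k * y x - z x - (U' x * y x + U x * (z x / x)) = - y x * (U' x + U x + U x ^ 2 / x - k)"
      by (simp add: algebra_simps power2_eq_square)
    also have "\<dots> < 0" using super[OF x] laguerre_neg_ge_1[of x k] x \<open>0 < a\<close>
      by (intro mult_neg_pos) (auto simp: y_def)
    finally show "k * y x - z x - (U' x * y x + U x * (z x / x)) < 0" .
  qed
  then show ?thesis by (simp add: y_def z_def)
qed

text \<open>Mirror image for a strict subsolution, with the sign of the test function
  reversed.\<close>

lemma laguerre_log_deriv_lower:
  fixes U U' :: "real \<Rightarrow> real"
  assumes "0 < a" "a \<le> b"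
    and init: "laguerre_euler k a > U a * laguerre_neg k a"
    and der: "\<And>x. a \<le> x \<Longrightarrow> x \<le> b \<Longrightarrow> (U has_real_derivative U' x) (at x)"
    and sub: "\<And>x. a \<le> x \<Longrightarrow> x \<le> b \<Longrightarrow> U' x + U x + U x ^ 2 / x < k"
  shows "laguerre_euler k b > U b * laguerre_neg k b"
proof -
  define y where "y = laguerre_neg k"
  define z where "z = laguerre_euler k"
  have "U b * y b - z b < 0"
  proof (rule negative_of_negative_deriv_at_zeros[OF \<open>a \<le> b\<close>])
    show "U a * y a - z a < 0" using init by (simp add: y_def z_def)
    fix x assume x: "a \<le> x" "x \<le> b"
    show "((\<lambda>x. U x * y x - z x) has_real_derivative
      (U' x * y x + U x * (z x / x)) - (k * y x - z x)) (at x)"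
      unfolding y_def z_def using x \<open>0 < a\<close>
      by (auto intro!: derivative_eq_intros der laguerre_neg_deriv laguerre_euler_deriv)
    assume "U x * y x - z x = 0"
    then have "(U' x * y x + U x * (z x / x)) - (k * y x - z x) = y x * (U' x + U x + U x ^ 2 / x - k)"
      by (simp add: algebra_simps power2_eq_square)
    also have "\<dots> < 0" using sub[OF x] laguerre_neg_ge_1[of x k] x \<open>0 < a\<close>
      by (intro mult_pos_neg) (auto simp: y_def)
    finally show "(U' x * y x + U x * (z x / x)) - (k * y x - z x) < 0" .
  qed
  then show ?thesis by (simp add: y_def z_def)
qed

section \<open>Stirling's formula\<close>

text \<open>The expression vanishes at 0, and its derivative \<open>ln (1 - u\<^sup>2)\<close> lies
  between \<open>- 3 * u\<^sup>2\<close> and 0 on this range.\<close>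

lemma midpoint_ln_bounds:
  fixes u :: real
  assumes "0 \<le> u" "u \<le> 1/2"
  shows "(1 + u) * ln (1 + u) - (1 - u) * ln (1 - u) - 2 * u \<le> 0"
    and "(1 + u) * ln (1 + u) - (1 - u) * ln (1 - u) - 2 * u \<ge> - (u ^ 3)"
proof -
  define p where "p = (\<lambda>u::real. (1 + u) * ln (1 + u) - (1 - u) * ln (1 - u) - 2 * u)"
  have der: "(p has_real_derivative ln (1 - t\<^sup>2)) (at t)" if "0 \<le> t" "t \<le> 1/2" for t
  proof -
    have "ln (1 - t\<^sup>2) = ln ((1 + t) * (1 - t))" by (simp add: algebra_simps power2_eq_square)
    also have "\<dots> = ln (1 + t) + ln (1 - t)" using that by (intro ln_mult_pos) auto
    finally show ?thesis unfolding p_def using that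
      by (auto intro!: derivative_eq_intros)
  qed
  have sq: "t\<^sup>2 \<le> 1/4" if "0 \<le> t" "t \<le> 1/2" for t :: real
    using power_mono[OF that(2,1), of 2] by (simp add: power2_eq_square)
  have "p u \<le> p 0"
  proof (rule DERIV_nonpos_imp_nonincreasing[OF assms(1)])
    fix t assume "0 \<le> t" "t \<le> u"
    with assms der[of t] sq[of t] show "\<exists>y. (p has_real_derivative y) (at t) \<and> y \<le> 0"
      by (intro exI[of _ "ln (1 - t\<^sup>2)"]) auto
  qed
  then show "(1 + u) * ln (1 + u) - (1 - u) * ln (1 - u) - 2 * u \<le> 0" by (simp add: p_def)
  have "p 0 + 0 ^ 3 \<le> p u + u ^ 3"
  proof (rule DERIV_nonneg_imp_nondecreasing[OF assms(1)])
    fix t assume t: "0 \<le> t" "t \<le> u"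
    then have t2: "t\<^sup>2 \<le> 1/4" using sq[of t] assms by auto
    have "ln (1 / (1 - t\<^sup>2)) \<le> 1 / (1 - t\<^sup>2) - 1" using t2 by (intro ln_le_minus_one) auto
    also have "\<dots> = t\<^sup>2 / (1 - t\<^sup>2)" using t2 by (simp add: field_simps)
    also have "\<dots> \<le> t\<^sup>2 / (1/3)" using t2 by (intro divide_left_mono) auto
    finally have "ln (1 - t\<^sup>2) + 3 * t\<^sup>2 \<ge> 0" using t2 by (simp add: ln_div)
    moreover have "((\<lambda>t. p t + t ^ 3) has_real_derivative ln (1 - t\<^sup>2) + 3 * t\<^sup>2) (at t)"
      using t assms by (auto intro!: derivative_eq_intros der)
    ultimately show "\<exists>y. ((\<lambda>t. p t + t ^ 3) has_real_derivative y) (at t) \<and> y \<ge> 0" by blast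
  qed
  then show "(1 + u) * ln (1 + u) - (1 - u) * ln (1 - u) - 2 * u \<ge> - (u ^ 3)" by (simp add: p_def)
qed

text \<open>Centring Stirling's formula at \<open>b = n + 1/2\<close> makes this the very constant
  that the comparison with the approximation leaves at infinity.\<close>

definition stirling_defect :: "nat \<Rightarrow> real" where
  "stirling_defect n = (n + 1/2) * ln (n + 1/2) - (n + 1/2) - ln (fact n)"

text \<open>With \<open>t = n + 1\<close> and \<open>u = 1 / (2 * t)\<close> the increment is
  \<open>t\<close> times the expression of \<open>midpoint_ln_bounds\<close>, hence between
  \<open>- 1 / (8 * t\<^sup>2)\<close> and 0. Replacing \<open>t\<^sup>2\<close> by
  \<open>t\<^sup>2 - 1/4\<close> makes the lower bound telescope.\<close>

lemma stirling_defect_step: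
  "stirling_defect (Suc n) \<le> stirling_defect n"
  "stirling_defect (Suc n) - 1 / (8 * (Suc n + 1/2)) \<ge> stirling_defect n - 1 / (8 * (n + 1/2))"
proof -
  define t where "t = real (Suc n)"
  define u where "u = 1 / (2 * t)"
  have t: "t \<ge> 1" by (simp add: t_def)
  then have u: "0 \<le> u" "u \<le> 1/2" by (auto simp: u_def field_simps)
  define p where "p = (1 + u) * ln (1 + u) - (1 - u) * ln (1 - u) - 2 * u"
  have e: "1 + u = (t + 1/2) / t" "1 - u = (t - 1/2) / t" using t by (auto simp: u_def field_simps)
  have l: "ln (1 + u) = ln (t + 1/2) - ln t" "ln (1 - u) = ln (t - 1/2) - ln t"
    unfolding e using t by (auto simp: ln_div)
  have "t * p = (t + 1/2) * ln (t + 1/2) - (t - 1/2) * ln (t - 1/2) - 1 - ln t"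
    unfolding p_def l unfolding e using t by (simp add: u_def field_simps)
  moreover have "stirling_defect (Suc n) - stirling_defect n
     = (t + 1/2) * ln (t + 1/2) - (t - 1/2) * ln (t - 1/2) - 1 - ln t"
  proof -
    have "ln (fact (Suc n)) = ln t + ln (fact n :: real)"
      by (simp add: t_def ln_mult_pos del: of_nat_Suc)
    moreover have n: "real n = t - 1" by (simp add: t_def)
    ultimately show ?thesis unfolding stirling_defect_def t_def[symmetric] n by simp
  qed
  ultimately have d: "stirling_defect (Suc n) - stirling_defect n = t * p" by simp
  have "p \<le> 0" "p \<ge> - (u ^ 3)" using midpoint_ln_bounds[OF u] by (auto simp: p_def)
  then have "t * p \<le> 0" "t * p \<ge> t * - (u ^ 3)"
    using t by (intro mult_nonneg_nonpos mult_left_mono; simp)+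
  moreover have "t * (u ^ 3) = 1 / (8 * t\<^sup>2)" using t by (simp add: u_def field_simps eval_nat_numeral)
  moreover have "1 / (8 * t\<^sup>2) \<le> 1 / (8 * (t\<^sup>2 - 1/4))"
  proof -
    have "t\<^sup>2 \<ge> 1" using t by (rule one_le_power)
    moreover have "1 / (8 * v) \<le> 1 / (8 * (v - 1/4))" if "v \<ge> 1" for v :: real
      using that by (intro frac_le) auto
    ultimately show ?thesis by blast
  qed
  moreover have "1 / (8 * (t\<^sup>2 - 1/4)) = 1 / (8 * (t - 1/2)) - 1 / (8 * (t + 1/2))"
  proof -
    have "t\<^sup>2 - 1/4 = (t - 1/2) * (t + 1/2)" by (simp add: algebra_simps power2_eq_square)
    moreover have "1 / (8 * (p * q)) = 1 / (8 * p) - 1 / (8 * q)" if "q - p = 1" "p > 0" "q > 0" for p q :: real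
    proof -
      have "1 / (8 * p) - 1 / (8 * q) = (q - p) / (8 * (p * q))" using that(2,3) by (simp add: field_simps)
      with that(1) show ?thesis by simp
    qed
    ultimately show ?thesis using t by simp
  qed
  ultimately have "stirling_defect (Suc n) - stirling_defect n \<le> 0"
    "stirling_defect (Suc n) - stirling_defect n \<ge> 1 / (8 * (t + 1/2)) - 1 / (8 * (t - 1/2))" using d by linarith+
  then show "stirling_defect (Suc n) \<le> stirling_defect n"
    "stirling_defect (Suc n) - 1 / (8 * (Suc n + 1/2)) \<ge> stirling_defect n - 1 / (8 * (n + 1/2))"
    by (simp_all add: t_def algebra_simps)
qed

section \<open>The Stirling constant from the Wallis product\<close>

lemma wallis_prod_eq:
  "(\<Prod>k=1..n. (4*real k^2) / (4*real k^2 - 1)) = 16 ^ n * fact n ^ 4 / ((fact (2 * n))\<^sup>2 * (2 * real n + 1))"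
proof (induction n)
  case (Suc n)
  define N where "N = real n"
  have N: "2 * N + 1 \<noteq> 0" "2 * N + 3 \<noteq> 0" "N + 1 \<noteq> 0" unfolding N_def by auto
  \<comment> \<open>The algebra of the induction step, with \<open>d = N + 1\<close>,
    \<open>a = 2 * N + 1\<close>, \<open>c = 2 * N + 3\<close>, \<open>P = 16 ^ n\<close>, and
    \<open>f\<close>, \<open>g\<close> the two factorials.\<close>
  have rearrange: "4 * d\<^sup>2 / (a * c) * (P * f ^ 4 / (g\<^sup>2 * a)) = 16 * P * (d * f) ^ 4 / ((2 * d * a * g)\<^sup>2 * c)"
    if "a \<noteq> 0" "c \<noteq> 0" "d \<noteq> 0" for a c d P f g :: real
    using that by (simp add: divide_simps) (simp add: eval_nat_numeral)
  have "(\<Prod>k=1..Suc n. (4*real k^2) / (4*real k^2 - 1)) =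
      (4*real (Suc n)^2) / (4*real (Suc n)^2 - 1) * (16 ^ n * fact n ^ 4 / ((fact (2 * n))\<^sup>2 * (2 * N + 1)))"
  proof -
    have "prod f {1..Suc n} = f (Suc n) * prod f {1..n}" for f :: "nat \<Rightarrow> real" by simp
    then show ?thesis using Suc.IH by (simp only: mult.commute N_def)
  qed
  also have "4 * real (Suc n) ^ 2 - 1 = (2 * N + 1) * (2 * N + 3)"
    by (simp add: algebra_simps power2_eq_square N_def)
  also have "real (Suc n) = N + 1" by (simp add: N_def)
  also note rearrange[OF N]
  also have "(N + 1) * fact n = fact (Suc n)" by (simp add: N_def)
  also have "2 * (N + 1) * (2 * N + 1) * fact (2 * n) = fact (2 * Suc n)" by (simp add: N_def algebra_simps)
  also have "2 * N + 3 = 2 * real (Suc n) + 1" by (simp add: N_def)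
  finally show ?case by simp
qed simp

text \<open>Monotonicity and the telescoping bound give a limit \<open>L\<close>. In the logarithm
  of the Wallis product the defects contribute \<open>- 4 * L + 2 * L\<close>, so the known limit
  \<open>pi / 2\<close> determines \<open>L\<close>.\<close>

lemma stirling_defect_limit: "stirling_defect \<longlonglongrightarrow> - ln (2 * pi) / 2"
proof -
  have mono: "decseq stirling_defect" by (rule decseq_SucI) (rule stirling_defect_step)
  have inc: "incseq (\<lambda>n. stirling_defect n - 1 / (8 * (n + 1/2)))"
    by (rule incseq_SucI) (rule stirling_defect_step)
  have "stirling_defect n \<ge> stirling_defect 0 - 1 / 4" for n
  proof -
    have "stirling_defect 0 - 1 / 4 \<le> stirling_defect n - 1 / (8 * (n + 1/2))"
      using incseqD[OF inc, of 0 n] by simp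
    also have "\<dots> \<le> stirling_defect n" by simp
    finally show ?thesis .
  qed
  with mono obtain L where L: "stirling_defect \<longlonglongrightarrow> L" using decseq_convergent by blast
  define W where "W = (\<lambda>n. \<Prod>k=1..n. (4*real k^2) / (4*real k^2 - 1))"
  define A where "A = (\<lambda>n. 4 * real n * ln 2 + 4 * ((real n + 1/2) * ln (real n + 1/2) - (real n + 1/2))
      - 2 * ((2 * real n + 1/2) * ln (2 * real n + 1/2) - (2 * real n + 1/2)) - ln (2 * real n + 1))"
  have lnW: "ln (W n) = A n - 4 * stirling_defect n + 2 * stirling_defect (2 * n)" for n
  proof -
    have "ln (W n) = n * ln 16 + 4 * ln (fact n) - 2 * ln (fact (2 * n)) - ln (2 * n + 1)"
      unfolding W_def wallis_prod_eq by (simp add: ln_div ln_mult_pos ln_realpow)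
    moreover have "ln (16::real) = 4 * ln 2" using ln_realpow[of 2 4] by simp
    ultimately show ?thesis by (simp add: stirling_defect_def A_def)
  qed
  have "(\<lambda>n. ln (W n)) \<longlonglongrightarrow> - 2 * ln 2 - 4 * L + 2 * L"
    unfolding lnW
  proof (intro tendsto_intros L)
    show "A \<longlonglongrightarrow> - 2 * ln 2"
      unfolding A_def by real_asymp
    show "(\<lambda>n. stirling_defect (2 * n)) \<longlonglongrightarrow> L"
      by (rule filterlim_compose[OF L]) real_asymp
  qed
  moreover have "(\<lambda>n. ln (W n)) \<longlonglongrightarrow> ln (pi / 2)"
    unfolding W_def by (intro tendsto_ln wallis) auto
  ultimately have "ln (pi / 2) = - 2 * ln 2 - 4 * L + 2 * L" using LIMSEQ_unique by blast
  then have "L = - ln (2 * pi) / 2" by (simp add: ln_div ln_mult_pos)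
  with L show ?thesis by simp
qed

text \<open>One sequence decreases and the other increases to the same limit.\<close>

lemma stirling_defect_bounds:
  "- ln (2 * pi) / 2 \<le> stirling_defect n"
  "stirling_defect n \<le> - ln (2 * pi) / 2 + 1 / (8 * (n + 1/2))"
proof -
  show "- ln (2 * pi) / 2 \<le> stirling_defect n"
    by (rule decseq_ge[OF _ stirling_defect_limit]) (rule decseq_SucI, rule stirling_defect_step)
  have "(\<lambda>n. stirling_defect n - 1 / (8 * (n + 1/2))) \<longlonglongrightarrow> - ln (2 * pi) / 2 - 0"
    by (intro tendsto_diff stirling_defect_limit) real_asymp
  from incseq_le[OF _ this] have "stirling_defect n - 1 / (8 * (n + 1/2)) \<le> - ln (2 * pi) / 2 - 0"
    using incseq_SucI[of "\<lambda>n. stirling_defect n - 1 / (8 * (n + 1/2))", OF stirling_defect_step(2)] by blast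
  then show "stirling_defect n \<le> - ln (2 * pi) / 2 + 1 / (8 * (n + 1/2))" by simp
qed

section \<open>The Liouville-Green approximation\<close>

locale liouville_green =
  fixes b :: real
  assumes b_pos: "b > 0"
begin

text \<open>The quotient \<open>R x / (2 * x)\<close> is \<open>sqrt (1/4 + b / x)\<close>, the root
  of the leading coefficient in the equation for \<open>w\<close>.\<close>

definition R :: "real \<Rightarrow> real" where "R x = sqrt (x\<^sup>2 + 4 * b * x)"

text \<open>The approximation is \<open>exp (\<Psi> x)\<close> up to the factor \<open>sqrt (2 * pi)\<close>.  Its logarithmic derivative is
  \<open>U 0 x / x\<close>, and \<open>U c x / x\<close> is this shifted by \<open>c / (x * R x)\<close>, with \<open>- G\<close> as an antiderivative
  of \<open>1 / (x * R x)\<close>.\<close>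

definition U :: "real \<Rightarrow> real \<Rightarrow> real" where
  "U c x = (R x - x) / 2 - (x + 2 * b) / (2 * (x + 4 * b)) + c / R x"

definition U' :: "real \<Rightarrow> real \<Rightarrow> real" where
  "U' c x = ((x + 2 * b) / R x - 1) / 2 - b / (x + 4 * b)\<^sup>2 - c * (x + 2 * b) / R x ^ 3"

definition \<Psi> :: "real \<Rightarrow> real" where
  "\<Psi> x = - ln (R x) / 2 - x / 2 + R x / 2 + b * ln ((x + 2 * b + R x) / (2 * b))"

definition G :: "real \<Rightarrow> real" where
  "G x = (sqrt (1 + 4 * b / x) - 1) / (2 * b)"

lemma R_sq: "x > 0 \<Longrightarrow> R x ^ 2 = x * (x + 4 * b)"
  using b_pos by (simp add: R_def algebra_simps power2_eq_square)

lemma R_pos: "x > 0 \<Longrightarrow> R x > 0"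
  using b_pos by (simp add: R_def add_pos_pos)

lemma R_gt: "x > 0 \<Longrightarrow> R x > x"
  unfolding R_def using b_pos by (intro real_less_rsqrt) simp

lemma R_mono: "0 < x \<Longrightarrow> x \<le> y \<Longrightarrow> R x \<le> R y"
  unfolding R_def using b_pos by (intro real_sqrt_le_mono add_mono mult_left_mono power_mono) auto

lemma R_deriv: "x > 0 \<Longrightarrow> (R has_real_derivative (x + 2 * b) / R x) (at x)"
proof -
  assume "x > 0"
  with b_pos have "x\<^sup>2 + 4 * b * x > 0" by (simp add: add_pos_pos)
  then show ?thesis unfolding R_def[abs_def]
    by (auto intro!: derivative_eq_intros) (simp add: field_simps)
qed

section \<open>The residual of \<open>U c\<close> in the Riccati equation\<close>

lemma U_deriv:
  assumes "x > 0"
  shows "(U c has_real_derivative U' c x) (at x)"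
proof -
  have [simp]: "R x \<noteq> 0" "R x > 0" "x + 4 * b > 0" "x + b * 4 \<noteq> 0" "x + 4 * b \<noteq> 0"
    using R_pos[OF assms] assms b_pos by auto
  have a: "((\<lambda>x. (x + 2 * b) / (2 * (x + 4 * b))) has_real_derivative b / (x + 4 * b)\<^sup>2) (at x)"
    using \<open>x + 4 * b > 0\<close>
    by (auto intro!: derivative_eq_intros simp del: distrib_left_numeral)
       (simp add: divide_simps power2_eq_square, (simp add: algebra_simps)?)
  have r: "((\<lambda>x. c / R x) has_real_derivative - (c * (x + 2 * b) / R x ^ 3)) (at x)"
    by (rule derivative_eq_intros refl R_deriv assms | simp)+ (simp add: field_simps eval_nat_numeral)
  have "(U c has_real_derivative ((x + 2 * b) / R x - 1) / 2 - b / (x + 4 * b)\<^sup>2 + - (c * (x + 2 * b) / R x ^ 3)) (at x)"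
    unfolding U_def[abs_def]
    by (intro DERIV_add DERIV_diff a r DERIV_cdivide R_deriv DERIV_ident assms)
  then show ?thesis by (simp add: U'_def)
qed

text \<open>The square \<open>R x ^ 2 = x * T\<close> is eliminated in favour of \<open>r = R x\<close> by parametrising
  \<open>b = (T - x) / 4\<close> and \<open>T = r ^ 2 / x\<close>.\<close>

lemma residual:
  assumes "x > 0"
  shows "U' c x + U c x + (U c x)\<^sup>2 / x - (b - 1/2) =
    (c * (R x - 1 - x\<^sup>2 / (R x)\<^sup>2) + (x\<^sup>2 / 4 + b\<^sup>2) * x\<^sup>2 / R x ^ 3 + c\<^sup>2 / R x) / (x * R x)"
proof -
  define r where "r = R x"
  have r: "r > 0" unfolding r_def by (rule R_pos[OF assms])
  have T: "x + 4 * b = r\<^sup>2 / x" using R_sq[OF assms] assms by (simp add: r_def field_simps)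
  then have b: "b = (r\<^sup>2 / x - x) / 4" by simp
  show ?thesis
    unfolding U_def U'_def r_def[symmetric] T
    unfolding b using r assms
    by (simp add: divide_simps) (simp add: algebra_simps eval_nat_numeral)
qed

text \<open>For \<open>c = 1\<close> the bracket in \<open>residual\<close> is at least
  \<open>(r - 1)\<^sup>2 / r\<close> plus a positive term.\<close>

lemma residual_upper:
  assumes "x > 0"
  shows "U' 1 x + U 1 x + (U 1 x)\<^sup>2 / x > b - 1/2"
proof -
  define r where "r = R x"
  have r: "r > x" "r > 0" unfolding r_def using R_gt R_pos assms by auto
  have "x\<^sup>2 / r\<^sup>2 \<le> 1" using r assms by (simp add: power_mono)
  moreover have "r - 2 + 1 / r \<ge> 0"
  proof -
    have "r - 2 + 1 / r = (r - 1)\<^sup>2 / r" using r by (simp add: field_simps power2_eq_square)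
    also have "\<dots> \<ge> 0" using r by simp
    finally show ?thesis .
  qed
  moreover have "(x\<^sup>2 / 4 + b\<^sup>2) * x\<^sup>2 / r ^ 3 > 0" using r assms b_pos by (simp add: add_pos_pos)
  ultimately have "1 * (r - 1 - x\<^sup>2 / r\<^sup>2) + (x\<^sup>2 / 4 + b\<^sup>2) * x\<^sup>2 / r ^ 3 + 1\<^sup>2 / r > 0" by simp
  then have "(1 * (r - 1 - x\<^sup>2 / r\<^sup>2) + (x\<^sup>2 / 4 + b\<^sup>2) * x\<^sup>2 / r ^ 3 + 1\<^sup>2 / r) / (x * r) > 0"
    using r assms by simp
  with residual[OF assms, of 1] show ?thesis unfolding r_def by linarith
qed

text \<open>For \<open>c = - 20\<close> the first term is at most \<open>- 20 * (r - 2)\<close>,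
  against at most \<open>r / 4\<close> and \<open>400 / r\<close> from the others; from
  \<open>r = 6\<close> on it dominates.\<close>

lemma residual_lower:
  assumes "x > 0" "R x \<ge> 6"
  shows "U' (-20) x + U (-20) x + (U (-20) x)\<^sup>2 / x < b - 1/2"
proof -
  define r where "r = R x"
  have r: "r > x" "r > 0" "r \<ge> 6" unfolding r_def using R_gt R_pos assms by auto
  have 1: "x\<^sup>2 / r\<^sup>2 \<le> 1" using r assms by (simp add: power_mono)
  have 2: "(x\<^sup>2 / 4 + b\<^sup>2) * x\<^sup>2 / r ^ 3 \<le> r / 4"
  proof -
    have "(x\<^sup>2 / 4 + b\<^sup>2) * x\<^sup>2 \<le> ((x + 4 * b)\<^sup>2 / 4) * x\<^sup>2"
      using assms b_pos by (intro mult_right_mono) (auto simp: power2_eq_square algebra_simps)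
    also have "\<dots> = r ^ 4 / 4"
      using power_mult[of r 2 2] R_sq[OF assms(1)] by (simp add: r_def power_mult_distrib)
    finally show ?thesis using r by (simp add: field_simps eval_nat_numeral)
  qed
  have 3: "400 / r \<le> 400 / 6" using r by (intro divide_left_mono) auto
  have *: "- 20 * (r - 1 - q) + s + (-20)\<^sup>2 / r < 0" if "q \<le> 1" "s \<le> r / 4" "400 / r \<le> 400 / 6" for q s
    using that r by simp
  have neg: "- 20 * (r - 1 - x\<^sup>2 / r\<^sup>2) + (x\<^sup>2 / 4 + b\<^sup>2) * x\<^sup>2 / r ^ 3 + (-20)\<^sup>2 / r < 0"
    by (rule *[OF 1 2 3])
  have "(- 20 * (r - 1 - x\<^sup>2 / r\<^sup>2) + (x\<^sup>2 / 4 + b\<^sup>2) * x\<^sup>2 / r ^ 3 + (-20)\<^sup>2 / r) / (x * r) < 0"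
    using r assms by (intro divide_neg_pos neg mult_pos_pos)
  with residual[OF assms(1), of "- 20"] show ?thesis unfolding r_def by linarith
qed

section \<open>The logarithm of the approximation and the integrated error\<close>

lemma \<Psi>_deriv:
  assumes "x > 0"
  shows "(\<Psi> has_real_derivative U 0 x / x) (at x)"
proof -
  define r where "r = R x"
  have r: "r > 0" unfolding r_def by (rule R_pos[OF assms])
  have T: "x + 4 * b = r\<^sup>2 / x" using R_sq[OF assms] assms by (simp add: r_def field_simps)
  have p: "x + 2 * b + r > 0" using r b_pos assms by simp
  have "((\<lambda>x. b * ln ((x + 2 * b + R x) / (2 * b))) has_real_derivative b / r) (at x)"
  proof -
    \<comment> \<open>This cancels the argument of the logarithm, which therefore contributes
      exactly \<open>b / r\<close>.\<close>
    have "1 + (x + 2 * b) / r = (x + 2 * b + r) / r" using r by (simp add: field_simps)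
    then show ?thesis using r p b_pos
      by (auto intro!: derivative_eq_intros R_deriv assms simp flip: r_def) (simp add: divide_simps)
  qed
  moreover have "((\<lambda>x. - ln (R x) / 2 - x / 2 + R x / 2) has_real_derivative
    - ((x + 2 * b) / r / r) / 2 - 1 / 2 + (x + 2 * b) / r / 2) (at x)"
    using r by (auto intro!: derivative_eq_intros R_deriv assms simp: divide_simps simp flip: r_def)
  ultimately have "(\<Psi> has_real_derivative
    - ((x + 2 * b) / r / r) / 2 - 1 / 2 + (x + 2 * b) / r / 2 + b / r) (at x)"
    unfolding \<Psi>_def[abs_def] by (rule DERIV_add[rotated])
  moreover have "- ((x + 2 * b) / r / r) / 2 - 1 / 2 + (x + 2 * b) / r / 2 + b / r = U 0 x / x"
  proof -
    have b: "b = (r\<^sup>2 / x - x) / 4" using T by simp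
    show ?thesis unfolding U_def T r_def[symmetric] unfolding b using r assms
      by (simp add: divide_simps) (simp add: algebra_simps eval_nat_numeral)
  qed
  ultimately show ?thesis by simp
qed

lemma G_deriv:
  assumes "x > 0"
  shows "(G has_real_derivative - (1 / (x * R x))) (at x)"
proof -
  have "1 + 4 * b / x > 0" using assms b_pos by (simp add: add_pos_pos)
  have "R x = sqrt (x\<^sup>2 * (1 + 4 * b / x))" using assms by (simp add: R_def field_simps power2_eq_square)
  then have "R x = x * sqrt (1 + 4 * b / x)" using assms by (simp add: real_sqrt_mult)
  then have "sqrt (1 + 4 * b / x) = R x / x" using assms by simp
  moreover have "(G has_real_derivative
      - (4 * b / x\<^sup>2) * inverse (sqrt (1 + 4 * b / x)) / 2 / (2 * b)) (at x)"
    unfolding G_def[abs_def] using assms b_pos \<open>1 + 4 * b / x > 0\<close>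
    by (auto intro!: derivative_eq_intros simp: power2_eq_square)
  ultimately show ?thesis using assms b_pos R_pos[OF assms]
    by (simp add: field_simps power2_eq_square)
qed

lemma G_limit: "(G \<longlongrightarrow> 0) at_top"
  unfolding G_def[abs_def] using b_pos by real_asymp

text \<open>Subadditivity of the square root splits off the 1, which cancels against the subtracted
  1.\<close>

lemma G_le:
  assumes "x > 0"
  shows "G x \<le> 1 / sqrt (b * x)"
proof -
  have "sqrt (1 + 4 * b / x) \<le> sqrt 1 + sqrt (4 * b / x)"
    using assms b_pos by (intro sqrt_add_le_add_sqrt) auto
  then have "G x \<le> sqrt (4 * b / x) / (2 * b)" unfolding G_def
    using b_pos by (intro divide_right_mono) auto
  also have "sqrt (4 * b / x) = 2 * sqrt b / sqrt x" by (simp add: real_sqrt_divide real_sqrt_mult)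
  also have "2 * sqrt b / sqrt x / (2 * b) = 1 / sqrt (b * x)"
    using assms b_pos real_sqrt_mult_self[of b] by (simp add: divide_simps real_sqrt_mult)
  finally show ?thesis .
qed

lemma G_nonneg: "x > 0 \<Longrightarrow> G x \<ge> 0"
  unfolding G_def using b_pos by simp

text \<open>As \<open>x\<close> grows, \<open>R x - x\<close> tends to \<open>2 * b\<close> and the
  last logarithm behaves like \<open>ln x - ln b\<close>. For \<open>b = k + 1/2\<close> the factor
  of \<open>ln x\<close> is \<open>k\<close>, the degree of the polynomial.\<close>

lemma \<Psi>_limit: "((\<lambda>x. \<Psi> x - (b - 1/2) * ln x) \<longlongrightarrow> b - b * ln b) at_top"
proof -
  have "((\<lambda>x. \<Psi> x - (b - 1/2) * ln x) \<longlongrightarrow> b + b * ln (inverse b)) at_top"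
    unfolding \<Psi>_def R_def using b_pos by real_asymp
  then show ?thesis using b_pos by (simp add: ln_inverse)
qed

end

section \<open>Comparison\<close>

text \<open>Near 0 the term \<open>1 / R x\<close> exceeds \<open>b\<close>, so \<open>U 1\<close>
  lies above \<open>k\<close> and hence above \<open>z / y\<close>; the barrier carries this to
  every \<open>x > 0\<close>.\<close>

lemma laguerre_log_deriv_le:
  assumes "x > 0" and b: "b = real k + 1/2"
  shows "laguerre_euler k x < liouville_green.U b 1 x * laguerre_neg k x"
proof -
  interpret liouville_green b by standard (simp add: b)
  \<comment> \<open>The bound by 1 gives \<open>(R a)\<^sup>2 \<le> a * (1 + 4 * b)\<close>; the
    last bound makes this less than \<open>1 / b\<^sup>2\<close>.\<close>
  define a where "a = min x (min 1 (1 / (2 * b\<^sup>2 * (1 + 4 * b))))"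
  have a: "a > 0" "a \<le> x" "a \<le> 1" "a \<le> 1 / (2 * b\<^sup>2 * (1 + 4 * b))"
    using b_pos \<open>x > 0\<close> by (auto simp: a_def)
  have "R a < 1 / b"
  proof (rule power2_less_imp_less)
    have "(R a)\<^sup>2 \<le> a * (1 + 4 * b)" using R_sq[of a] a by simp
    also have "\<dots> \<le> 1 / (2 * b\<^sup>2 * (1 + 4 * b)) * (1 + 4 * b)"
      using a b_pos by (intro mult_right_mono) auto
    also have "\<dots> = 1 / (2 * b\<^sup>2)" using b_pos by simp
    also have "\<dots> < (1 / b)\<^sup>2" using b_pos by (simp add: field_simps)
    finally show "(R a)\<^sup>2 < (1 / b)\<^sup>2" .
  qed (use b_pos in simp)
  then have "1 / R a > b" using R_pos[of a] a b_pos by (simp add: field_simps)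
  moreover have "(a + 2 * b) / (2 * (a + 4 * b)) \<le> 1/2" using a b_pos by (simp add: field_simps)
  moreover have "(r - a) / 2 - q + e > b - 1/2" if "e > b" "q \<le> 1/2" "r > a" for r q e
    using that by (simp add: field_simps)
  ultimately have "U 1 a > b - 1/2" using R_gt[OF a(1)] unfolding U_def by blast
  then have "U 1 a > k" using b by linarith
  with laguerre_neg_ge_1[of a k] a have "k * laguerre_neg k a < U 1 a * laguerre_neg k a" by simp
  with laguerre_euler_le[of a k] a have "laguerre_euler k a < U 1 a * laguerre_neg k a" by simp
  then show ?thesis
  proof (rule laguerre_log_deriv_upper[OF a(1,2)])
    fix t assume "a \<le> t"
    with a have "t > 0" by simp
    then show "(U 1 has_real_derivative U' 1 t) (at t)" "U' 1 t + U 1 t + (U 1 t)\<^sup>2 / t > k"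
      using U_deriv[of t 1] residual_upper[of t] by (simp_all add: b)
  qed
qed

text \<open>The barrier starts where \<open>R = 6\<close>: there \<open>- 20 / R\<close> outweighs
  \<open>(R - x) / 2\<close>, so \<open>U (-20)\<close> is negative while \<open>z\<close> is
  nonnegative. Beyond that point \<open>R\<close> stays at least 6.\<close>

lemma laguerre_log_deriv_ge:
  assumes "x > 0" and b: "b = real k + 1/2" and large: "liouville_green.R b x \<ge> 6"
  shows "laguerre_euler k x > liouville_green.U b (-20) x * laguerre_neg k x"
proof -
  interpret liouville_green b by standard (simp add: b)
  \<comment> \<open>The positive solution of \<open>R a = 6\<close>, found by completing the
    square.\<close>
  define a where "a = sqrt (4 * b\<^sup>2 + 36) - 2 * b"
  have sq: "(t + 2 * b)\<^sup>2 = (R t)\<^sup>2 + 4 * b\<^sup>2" if "t > 0" for t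
    using R_sq[OF that] by (simp add: algebra_simps power2_eq_square)
  have "2 * b < sqrt (4 * b\<^sup>2 + 36)" by (rule real_less_rsqrt) (simp add: power2_eq_square)
  then have a: "a > 0" by (simp add: a_def)
  have "(a + 2 * b)\<^sup>2 = 4 * b\<^sup>2 + 36" by (simp add: a_def)
  with sq[OF a] have "(R a)\<^sup>2 = 6\<^sup>2" by simp
  then have Ra: "R a = 6" using R_pos[OF a] by (simp only: power2_eq_iff) auto
  have "a \<le> x"
  proof -
    have "(R x)\<^sup>2 \<ge> 6\<^sup>2" using large by (intro power_mono) auto
    with sq[OF \<open>x > 0\<close>] have "sqrt (4 * b\<^sup>2 + 36) \<le> x + 2 * b"
      using \<open>x > 0\<close> b_pos by (intro real_le_lsqrt) auto
    then show ?thesis by (simp add: a_def)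
  qed
  have "(a + 2 * b) / (2 * (a + 4 * b)) \<ge> 1/4" using a b_pos by (simp add: field_simps)
  moreover have "(6 - a) / 2 - q + (- 20) / 6 < 0" if "q \<ge> 1/4" for q
    using that a by (simp add: field_simps)
  ultimately have "U (-20) a < 0" unfolding U_def Ra by blast
  with laguerre_neg_ge_1[of a k] a have "U (-20) a * laguerre_neg k a < 0" by (simp add: mult_neg_pos)
  with laguerre_euler_nonneg[of a k] a have "laguerre_euler k a > U (-20) a * laguerre_neg k a" by simp
  then show ?thesis
  proof (rule laguerre_log_deriv_lower[OF a \<open>a \<le> x\<close>])
    fix t assume t: "a \<le> t"
    then have "t > 0" "R t \<ge> 6" using R_mono[OF a t] Ra a by simp_all
    then show "(U (-20) has_real_derivative U' (-20) t) (at t)" "U' (-20) t + U (-20) t + (U (-20) t)\<^sup>2 / t < k"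
      using U_deriv[of t "- 20"] residual_lower[of t] by (simp_all add: b)
  qed
qed

text \<open>The difference \<open>\<Phi>\<close> tends to \<open>stirling_defect k\<close> at
  infinity. The barriers put its derivative between \<open>- 20 / (t * R t)\<close> and
  \<open>1 / (t * R t)\<close>, so from \<open>x\<close> on \<open>\<Phi> + G\<close> decreases and
  \<open>\<Phi> - 20 * G\<close> increases to that limit.\<close>

lemma ln_laguerre_neg_bounds:
  assumes "x > 0" and b: "b = real k + 1/2" and large: "liouville_green.R b x \<ge> 6"
  shows "ln (laguerre_neg k x) - liouville_green.\<Psi> b x \<ge> stirling_defect k - liouville_green.G b x"
    and "ln (laguerre_neg k x) - liouville_green.\<Psi> b x \<le> stirling_defect k + 20 * liouville_green.G b x"
proof -
  interpret liouville_green b by standard (simp add: b)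
  define \<Phi> where "\<Phi> = (\<lambda>t. ln (laguerre_neg k t) - \<Psi> t)"
  have lim: "(\<Phi> \<longlongrightarrow> stirling_defect k) at_top"
  proof -
    have "((\<lambda>t. ln (laguerre_neg k t / t ^ k) - (\<Psi> t - (b - 1/2) * ln t)) \<longlongrightarrow>
        ln (1 / fact k) - (b - b * ln b)) at_top"
      by (intro tendsto_diff tendsto_ln laguerre_neg_asymp \<Psi>_limit) simp
    moreover have "ln (1 / fact k) - (b - b * ln b) = stirling_defect k"
      by (simp add: stirling_defect_def b ln_div)
    moreover have "\<forall>\<^sub>F t in at_top. ln (laguerre_neg k t / t ^ k) - (\<Psi> t - (b - 1/2) * ln t) = \<Phi> t"
      using eventually_gt_at_top[of 0]
    proof eventually_elim
      case (elim t)
      then show ?case using laguerre_neg_ge_1[of t k] by (simp add: \<Phi>_def ln_div ln_realpow b)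
    qed
    ultimately show ?thesis using Lim_transform_eventually by (simp only:) blast
  qed
  define q where "q = (\<lambda>t. laguerre_euler k t / (t * laguerre_neg k t) - U 0 t / t)"
  have \<Phi>_deriv: "(\<Phi> has_real_derivative q t) (at t)" if "t > 0" for t
    unfolding \<Phi>_def q_def using that by (intro DERIV_diff ln_laguerre_neg_deriv \<Psi>_deriv)
  have U_split: "U c t = U 0 t + c / R t" for c t by (simp add: U_def)
  have q: "q t \<le> 1 / (t * R t)" "q t \<ge> - 20 / (t * R t)" if "t \<ge> x" for t
  proof -
    have t: "t > 0" using that \<open>x > 0\<close> by simp
    have y: "laguerre_neg k t > 0" using laguerre_neg_ge_1[of t k] t by simp
    have "R t \<ge> 6" using R_mono[OF \<open>x > 0\<close> that] large by simp
    with laguerre_log_deriv_le[OF t b] laguerre_log_deriv_ge[OF t b]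
    have "laguerre_euler k t / laguerre_neg k t \<le> U 0 t + 1 / R t"
      "laguerre_euler k t / laguerre_neg k t \<ge> U 0 t + (- 20) / R t"
      using y unfolding U_split[of 1] U_split[of "-20"]
      by (simp_all add: pos_divide_le_eq pos_le_divide_eq)
    moreover have "q t = (laguerre_euler k t / laguerre_neg k t - U 0 t) / t"
      using t by (simp add: q_def field_simps)
    moreover have "(v - u) / t \<le> c / t" if "v \<le> u + c" for v u c
      using that t by (intro divide_right_mono) auto
    moreover have "(v - u) / t \<ge> c / t" if "v \<ge> u + c" for v u c
      using that t by (intro divide_right_mono) auto
    ultimately have "q t \<le> (1 / R t) / t" "q t \<ge> (- 20 / R t) / t"
      by (simp_all only:)
    then show "q t \<le> 1 / (t * R t)" "q t \<ge> - 20 / (t * R t)"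
      by (simp_all add: mult.commute)
  qed
  have "\<Phi> x + G x \<ge> stirling_defect k + 0"
  proof (rule tendsto_upperbound)
    show "((\<lambda>t. \<Phi> t + G t) \<longlongrightarrow> stirling_defect k + 0) at_top"
      by (intro tendsto_add lim G_limit)
    show "\<forall>\<^sub>F t in at_top. \<Phi> t + G t \<le> \<Phi> x + G x"
      using eventually_ge_at_top[of x]
    proof eventually_elim
      case (elim t)
      show ?case
      proof (rule DERIV_nonpos_imp_nonincreasing[OF elim])
        fix s assume "x \<le> s"
        with \<open>x > 0\<close> q(1)[of s]
        show "\<exists>y. ((\<lambda>t. \<Phi> t + G t) has_real_derivative y) (at s) \<and> y \<le> 0"
          by (intro exI[of _ "q s + - (1 / (s * R s))"] conjI DERIV_add \<Phi>_deriv G_deriv) auto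
      qed
    qed
  qed simp
  then show "ln (laguerre_neg k x) - \<Psi> x \<ge> stirling_defect k - G x" by (simp add: \<Phi>_def)
  have "\<Phi> x - 20 * G x \<le> stirling_defect k - 20 * 0"
  proof (rule tendsto_lowerbound)
    show "((\<lambda>t. \<Phi> t - 20 * G t) \<longlongrightarrow> stirling_defect k - 20 * 0) at_top"
      by (intro tendsto_diff tendsto_mult tendsto_const lim G_limit)
    show "\<forall>\<^sub>F t in at_top. \<Phi> x - 20 * G x \<le> \<Phi> t - 20 * G t"
      using eventually_ge_at_top[of x]
    proof eventually_elim
      case (elim t)
      show ?case
      proof (rule DERIV_nonneg_imp_nondecreasing[OF elim])
        fix s assume "x \<le> s"
        with \<open>x > 0\<close> q(2)[of s]
        show "\<exists>y. ((\<lambda>t. \<Phi> t - 20 * G t) has_real_derivative y) (at s) \<and> 0 \<le> y"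
          by (intro exI[of _ "q s - 20 * (- (1 / (s * R s)))"] conjI DERIV_diff DERIV_cmult \<Phi>_deriv G_deriv) auto
      qed
    qed
  qed simp
  then show "ln (laguerre_neg k x) - \<Psi> x \<le> stirling_defect k + 20 * G x" by (simp add: \<Phi>_def)
qed

section \<open>Passage to the variables of the theorem\<close>

lemma arsinh_le:
  assumes "x \<ge> 0"
  shows "arsinh x \<le> (x::real)"
proof -
  \<comment> \<open>This bounds the argument of the logarithm by the quadratic Taylor polynomial of
    \<open>exp x\<close>.\<close>
  have "sqrt (x\<^sup>2 + 1) \<le> sqrt ((1 + x\<^sup>2 / 2)\<^sup>2)"
    by (intro real_sqrt_le_mono) (use assms in \<open>simp add: power2_eq_square algebra_simps\<close>)
  then have "x + sqrt (x\<^sup>2 + 1) \<le> 1 + x + x\<^sup>2 / 2" by simp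
  also have "\<dots> \<le> exp x" using exp_lower_Taylor_quadratic[OF assms] by simp
  finally have "ln (x + sqrt (x\<^sup>2 + 1)) \<le> ln (exp x)"
    using arsinh_real_aux[of x] by (subst ln_le_cancel_iff) auto
  then show ?thesis by (simp add: arsinh_real_def)
qed

text \<open>With \<open>s = sqrt (b + g\<^sup>2 / 4)\<close> one has
  \<open>R (g\<^sup>2) = 2 * g * s\<close>, which turns the prefactor into
  \<open>(2 * pi * R (g\<^sup>2)) powr (- 1 / 2)\<close>. Squaring inside the logarithm turns
  \<open>2 * arsinh\<close> into the logarithm in \<open>\<Psi>\<close>.\<close>

lemma leading_term_eq:
  assumes "b > 0" "g > 0"
  shows "(4 * pi * g * sqrt (b + g\<^sup>2 / 4)) powr (- 1 / 2)
      * exp (- (g\<^sup>2) / 2 + g * sqrt (b + g\<^sup>2 / 4) + 2 * b * arsinh (g / (2 * sqrt b)))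
    = exp (liouville_green.\<Psi> b (g\<^sup>2) - ln (2 * pi) / 2)"
proof -
  interpret liouville_green b by standard fact
  define s where "s = sqrt (b + g\<^sup>2 / 4)"
  have s: "s > 0" "s\<^sup>2 = b + g\<^sup>2 / 4" using assms by (auto simp: s_def add_pos_pos)
  have R: "R (g\<^sup>2) = 2 * g * s"
  proof (rule power2_eq_imp_eq)
    show "(R (g\<^sup>2))\<^sup>2 = (2 * g * s)\<^sup>2"
      using R_sq[of "g\<^sup>2"] assms s by (simp add: power_mult_distrib algebra_simps)
  qed (use R_pos[of "g\<^sup>2"] assms s in auto)
  define z where "z = g / (2 * sqrt b)"
  have "sqrt (z\<^sup>2 + 1) = s / sqrt b"
  proof -
    have "z\<^sup>2 + 1 = s\<^sup>2 / b" using assms s by (simp add: z_def power_divide power_mult_distrib field_simps)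
    then have "sqrt (z\<^sup>2 + 1) = sqrt (s\<^sup>2) / sqrt b" by (simp only: real_sqrt_divide)
    also have "sqrt (s\<^sup>2) = s" using s(1) by simp
    finally show ?thesis .
  qed
  then have "z + sqrt (z\<^sup>2 + 1) = (g + 2 * s) / (2 * sqrt b)" using assms by (simp add: z_def field_simps)
  moreover have "2 * ln ((g + 2 * s) / (2 * sqrt b)) = ln (((g + 2 * s) / (2 * sqrt b))\<^sup>2)"
    using s assms by (subst ln_realpow) auto
  moreover have "((g + 2 * s) / (2 * sqrt b))\<^sup>2 = (g\<^sup>2 + 2 * b + R (g\<^sup>2)) / (2 * b)"
  proof -
    have "(g + 2 * s)\<^sup>2 = 2 * (g\<^sup>2 + 2 * b + R (g\<^sup>2))" using s(2) by (simp add: R power2_sum power_mult_distrib)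
    then show ?thesis using assms by (simp add: power_divide power_mult_distrib field_simps)
  qed
  ultimately have ars: "2 * arsinh z = ln ((g\<^sup>2 + 2 * b + R (g\<^sup>2)) / (2 * b))"
    unfolding arsinh_real_def by simp
  have "4 * pi * g * s = 2 * pi * R (g\<^sup>2)" by (simp add: R)
  moreover have "ln (2 * pi * R (g\<^sup>2)) = ln (2 * pi) + ln (R (g\<^sup>2))"
    using R_pos[of "g\<^sup>2"] assms by (intro ln_mult_pos) auto
  ultimately have "(4 * pi * g * s) powr (- 1 / 2) = exp (- 1 / 2 * (ln (2 * pi) + ln (R (g\<^sup>2))))"
    using R_pos[of "g\<^sup>2"] assms by (simp only: powr_def) simp
  moreover have "- 1 / 2 * (ln (2 * pi) + ln (R (g\<^sup>2))) + (- (g\<^sup>2) / 2 + g * s + 2 * b * arsinh z)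
      = \<Psi> (g\<^sup>2) - ln (2 * pi) / 2"
  proof -
    have "2 * b * arsinh z = b * (2 * arsinh z)" by simp
    moreover have "g * s = R (g\<^sup>2) / 2" by (simp add: R)
    ultimately show ?thesis unfolding ars \<Psi>_def by (simp add: field_simps)
  qed
  ultimately show ?thesis unfolding s_def[symmetric] z_def[symmetric] by (simp flip: exp_add)
qed

text \<open>For \<open>d \<ge> 0\<close> multiply \<open>1 - d \<le> exp (- d)\<close> by
  \<open>exp d\<close>; for negative \<open>d\<close> already
  \<open>1 - exp d \<le> \<bar>d\<bar>\<close>.\<close>

lemma abs_exp_minus_one_le: "\<bar>exp d - 1\<bar> \<le> \<bar>d\<bar> * exp \<bar>d\<bar>" for d :: real
proof (cases "d \<ge> 0")
  case True
  have "(1 - d) * exp d \<le> exp (- d) * exp d"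
    using exp_ge_add_one_self[of "- d"] by (intro mult_right_mono) auto
  then show ?thesis using True by (simp add: algebra_simps flip: exp_add)
next
  case False
  have "1 - exp d \<le> \<bar>d\<bar> * 1" using exp_ge_add_one_self[of d] False by linarith
  also have "\<dots> \<le> \<bar>d\<bar> * exp \<bar>d\<bar>" by (intro mult_left_mono) auto
  finally show ?thesis using False by simp
qed

text \<open>Since \<open>(R (g\<^sup>2))\<^sup>2\<close> is at least
  \<open>4 * b * g\<^sup>2\<close>, the condition on \<open>sqrt b * g\<close> yields
  \<open>R (g\<^sup>2) \<ge> 6\<close>. In the bound on \<open>\<delta>\<close>, Stirling accounts
  for \<open>1 / (8 * b)\<close> and \<open>20 * G\<close> for the rest.\<close>

lemma laguerre_asymptotics:
  assumes b: "b = real k + 1/2" and "g > 0" and large: "sqrt b * g \<ge> 3"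
  obtains \<delta> where "\<bar>\<delta>\<bar> \<le> 1 / (8 * b) + 20 / (sqrt b * g)"
    and "laguerre k (- (g\<^sup>2)) = (4 * pi * g * sqrt (b + g\<^sup>2 / 4)) powr (- 1 / 2)
      * exp (- (g\<^sup>2) / 2 + g * sqrt (b + g\<^sup>2 / 4) + 2 * b * arsinh (g / (2 * sqrt b))) * exp \<delta>"
proof
  interpret liouville_green b by standard (simp add: b)
  define \<delta> where "\<delta> = ln (laguerre_neg k (g\<^sup>2)) - \<Psi> (g\<^sup>2) + ln (2 * pi) / 2"
  have x: "g\<^sup>2 > 0" using \<open>g > 0\<close> by simp
  have root: "sqrt (b * g\<^sup>2) = sqrt b * g" using \<open>g > 0\<close> by (simp add: real_sqrt_mult)
  have "R (g\<^sup>2) \<ge> 6"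
  proof (rule power2_le_imp_le)
    have "(6::real)\<^sup>2 \<le> 4 * (sqrt b * g)\<^sup>2" using power_mono[OF large, of 2] by simp
    also have "\<dots> \<le> (R (g\<^sup>2))\<^sup>2" using R_sq[OF x] b_pos by (simp add: power_mult_distrib algebra_simps)
    finally show "6\<^sup>2 \<le> (R (g\<^sup>2))\<^sup>2" .
  qed (use R_pos[OF x] in simp)
  note bounds = ln_laguerre_neg_bounds[OF x b this]
  have G: "0 \<le> G (g\<^sup>2)" "G (g\<^sup>2) \<le> 1 / (sqrt b * g)"
    using G_nonneg[OF x] G_le[OF x] by (simp_all add: root)
  then have "20 * G (g\<^sup>2) \<le> 20 / (sqrt b * g)" by simp
  with bounds G stirling_defect_bounds[of k] b_pos show "\<bar>\<delta>\<bar> \<le> 1 / (8 * b) + 20 / (sqrt b * g)"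
    unfolding \<delta>_def b[symmetric] by (intro abs_leI) (auto intro: order_trans)
  have "laguerre k (- (g\<^sup>2)) = exp (\<Psi> (g\<^sup>2) - ln (2 * pi) / 2) * exp \<delta>"
    using laguerre_neg_ge_1[of "g\<^sup>2" k] by (simp add: \<delta>_def laguerre_minus flip: exp_add)
  then show "laguerre k (- (g\<^sup>2)) = (4 * pi * g * sqrt (b + g\<^sup>2 / 4)) powr (- 1 / 2)
      * exp (- (g\<^sup>2) / 2 + g * sqrt (b + g\<^sup>2 / 4) + 2 * b * arsinh (g / (2 * sqrt b))) * exp \<delta>"
    unfolding leading_term_eq[OF b_pos \<open>g > 0\<close>] .
qed

theorem corollary6p5:
  fixes p1 p2 :: real
  assumes "p1 > 0" and "p2 > 0" and "p1 + p2 < 1 / 2"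
  shows "\<exists>K::real. K > 0 \<and> (\<exists>C::real. C > 0 \<and>
    (\<forall>(k::nat) (\<gamma>::real). let k1 = real k + 1 / 2 in
      real k \<ge> K \<and> \<gamma> > 0 \<and>
      3 / 8 * k1 powr (- 2 * p2) \<le> arsinh (\<gamma> / (2 * sqrt k1)) \<and>
      arsinh (\<gamma> / (2 * sqrt k1)) \<le> p2 * ln k1 \<longrightarrow>
      (\<exists>\<epsilon>::real. \<bar>\<epsilon>\<bar> \<le> C * real k powr (- p1) \<and>
        laguerre k (- (\<gamma>\<^sup>2)) =
          (4 * pi * \<gamma> * sqrt (k1 + \<gamma>\<^sup>2 / 4)) powr (- 1 / 2)
          * exp (- (\<gamma>\<^sup>2) / 2 + \<gamma> * sqrt (k1 + \<gamma>\<^sup>2 / 4)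
                 + 2 * k1 * arsinh (\<gamma> / (2 * sqrt k1)))
          * (1 + \<epsilon>))))"
proof -
  \<comment> \<open>Chosen so that \<open>b \<ge> K\<close> forces
    \<open>b powr (1 - 2 * p2) \<ge> 4\<close>, which leads to
    \<open>sqrt b * \<gamma> \<ge> 3\<close>.\<close>
  define K :: real where "K = 4 powr (1 / (1 - 2 * p2))"
  \<comment> \<open>The number 27 covers \<open>1/8 + 20 * (4/3)\<close>; \<open>exp 27\<close> pays
    for passing from \<open>\<delta>\<close> to \<open>exp \<delta> - 1\<close>.\<close>
  define C :: real where "C = 27 * exp 27"
  \<comment> \<open>The second bound holds because
    \<open>p1 + 2 * p2 \<le> 2 * (p1 + p2) < 1\<close>.\<close>
  have p: "1 - 2 * p2 > 0" "1 - 2 * p2 \<ge> p1" "p1 < 1" using assms by auto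
  have "\<exists>\<epsilon>::real. \<bar>\<epsilon>\<bar> \<le> C * real k powr (- p1) \<and>
        laguerre k (- (\<gamma>\<^sup>2)) =
          (4 * pi * \<gamma> * sqrt (b + \<gamma>\<^sup>2 / 4)) powr (- 1 / 2)
          * exp (- (\<gamma>\<^sup>2) / 2 + \<gamma> * sqrt (b + \<gamma>\<^sup>2 / 4)
                 + 2 * b * arsinh (\<gamma> / (2 * sqrt b)))
          * (1 + \<epsilon>)"
    if b: "b = real k + 1/2" and "real k \<ge> K" and "\<gamma> > 0"
      and lower: "3 / 8 * b powr (- 2 * p2) \<le> arsinh (\<gamma> / (2 * sqrt b))" for k \<gamma> b
  proof -
    have "K \<ge> 1" unfolding K_def using p by (intro ge_one_powr_ge_zero) auto
    with \<open>real k \<ge> K\<close> b have k: "real k \<ge> 1" "b \<ge> 1" "real k \<le> b" "K \<le> b" by auto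
    define B where "B = b powr (1 - 2 * p2)"
    define \<kappa> where "\<kappa> = real k powr (- p1)"
    \<comment> \<open>The lower bound on \<open>arsinh\<close> becomes one on its argument;
      multiplying by \<open>2 * b\<close> then isolates \<open>sqrt b * \<gamma>\<close>.\<close>
    have "3 / 8 * b powr (- 2 * p2) \<le> \<gamma> / (2 * sqrt b)"
      using lower arsinh_le[of "\<gamma> / (2 * sqrt b)"] \<open>\<gamma> > 0\<close> k by simp
    then have "3 / 8 * b powr (- 2 * p2) * (2 * b) \<le> \<gamma> / (2 * sqrt b) * (2 * b)"
      using k by (intro mult_right_mono) auto
    moreover have "3 / 8 * b powr (- 2 * p2) * (2 * b) = 3 / 4 * B"
      using k by (simp add: B_def powr_diff powr_minus field_simps)
    moreover have "\<gamma> / (2 * sqrt b) * (2 * b) = sqrt b * \<gamma>"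
    proof -
      have "\<gamma> / (2 * sqrt b) * (2 * b) = \<gamma> * (b / sqrt b)" by simp
      also have "b / sqrt b = sqrt b" using k by (intro real_div_sqrt) simp
      finally show ?thesis by (simp only: mult.commute)
    qed
    ultimately have s: "sqrt b * \<gamma> \<ge> 3 / 4 * B" by (simp only:)
    have "4 = K powr (1 - 2 * p2)" using p by (simp add: K_def powr_powr)
    also have "\<dots> \<le> B" unfolding B_def using k p \<open>K \<ge> 1\<close> by (intro powr_mono2) auto
    finally have "B \<ge> 4" .
    with s have "sqrt b * \<gamma> \<ge> 3" by simp
    from laguerre_asymptotics[OF b \<open>\<gamma> > 0\<close> this] obtain \<delta>
      where \<delta>: "\<bar>\<delta>\<bar> \<le> 1 / (8 * b) + 20 / (sqrt b * \<gamma>)"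
        and eq: "laguerre k (- (\<gamma>\<^sup>2)) = (4 * pi * \<gamma> * sqrt (b + \<gamma>\<^sup>2 / 4)) powr (- 1 / 2)
          * exp (- (\<gamma>\<^sup>2) / 2 + \<gamma> * sqrt (b + \<gamma>\<^sup>2 / 4) + 2 * b * arsinh (\<gamma> / (2 * sqrt b))) * exp \<delta>"
      by blast
    have \<kappa>: "b powr (- q) \<le> \<kappa>" if "q \<ge> p1" for q
    proof -
      have "b powr (- q) \<le> b powr (- p1)" using k that by (intro powr_mono) auto
      also have "\<dots> \<le> \<kappa>" unfolding \<kappa>_def using k \<open>p1 > 0\<close> by (intro powr_mono2') auto
      finally show ?thesis .
    qed
    \<comment> \<open>Both error sources, \<open>1 / b\<close> and \<open>1 / B\<close>, are powers
      of \<open>b\<close> whose decay exponents are at least \<open>p1\<close>.\<close>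
    have "1 / b \<le> \<kappa>" using \<kappa>[of 1] p k by (simp add: powr_minus_divide)
    moreover have "1 / B \<le> \<kappa>" using \<kappa>[of "1 - 2 * p2"] p unfolding B_def powr_minus_divide by simp
    moreover have "20 / (sqrt b * \<gamma>) \<le> 20 / (3 / 4 * B)"
      using s \<open>B \<ge> 4\<close> k \<open>\<gamma> > 0\<close> by (intro divide_left_mono mult_pos_pos) auto
    ultimately have "\<bar>\<delta>\<bar> \<le> 27 * \<kappa>" using \<delta> by simp
    have "\<kappa> \<le> 1" unfolding \<kappa>_def using k \<open>p1 > 0\<close> by (simp add: powr_minus ge_one_powr_ge_zero inverse_le_1_iff)
    have "\<bar>exp \<delta> - 1\<bar> \<le> \<bar>\<delta>\<bar> * exp \<bar>\<delta>\<bar>" by (rule abs_exp_minus_one_le)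
    also have "\<dots> \<le> (27 * \<kappa>) * exp 27"
      using \<open>\<bar>\<delta>\<bar> \<le> 27 * \<kappa>\<close> \<open>\<kappa> \<le> 1\<close> by (intro mult_mono) auto
    finally have "\<bar>exp \<delta> - 1\<bar> \<le> C * real k powr (- p1)" by (simp add: C_def \<kappa>_def mult_ac)
    with eq show ?thesis by (intro exI[of _ "exp \<delta> - 1"]) simp
  qed
  moreover have "K > 0" "C > 0" by (auto simp: K_def C_def)
  ultimately show ?thesis unfolding Let_def by blast
qed

end
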